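(* Let $x$ and $y$ be representations of a countable set $A$ with $\mathrm{comp}(x)\subseteq\mathrm{comp}(y)$, and suppose $x(A)$ is computationally enumerable. Then $x$ and $y$ are transformationally equivalent, i.e., both $y\circ x^{-1}$ (on $x(A)$) and $x\circ y^{-1}$ (on $y(A)$) are computable.
   Context: $\mathbb{T}$ denotes the set of tapes over a fixed finite alphabet with finitely many non-blank symbols. For $Q\subseteq\mathbb{T}$, a function with domain $Q$ and values in $\mathbb{T}$ is computable if some Turing machine, on every input $\tau\in Q$, halts with output equal to the function's value (nothing is required outside $Q$). A set $Q\subseteq\mathbb{T}$ is computationally enumerable (c.e.) if there is a computable function $h$ with domain $Q$ and values in $Q$ and a tape $\tau_0\in Q$ such that each $\tau\in Q$ equals $h^i(\tau_0)$ for some $i$ (equivalently, some Turing machine halts exactly on the tapes of $Q$). A representation of $A$ is an injective function $A\to\mathbb{T}$; for a representation $x$, $\mathrm{comp}(x)$ is the set of functions $g$ with domain $A$ and values in $A$ such that $x\circ g\circ x^{-1}$ (defined on $x(A)$) is computable. Standing assumptions: a fixed tape pairing bijection with computable duplication, swap, projections and partial application, and a Turing machine deciding equality of the two components of a pair. *)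

theory Defs
  imports "HOL-Library.Finite_Map" "HOL-Library.FuncSet" "HOL-Library.Countable_Set"
begin

text \<open>
  The alphabet consists of a blank together with the non-blank symbols \<^typ>\<open>'a\<close>, a finite type.
  A tape is a two-way infinite sequence of symbols, only finitely many of them non-blank; it is
  stored as the finite map from positions to non-blank symbols. The head stands at position \<open>0\<close>.
\<close>

type_synonym 'a tape = "(int, 'a) fmap"

text \<open>
  A machine must be able to recognise the end of its input: if it could not tell the blanks within
  the input from those beyond it, it could never know that it has seen every non-blank symbol, and
  not even constant functions on the set of all tapes would be computable. Hence the cells beyond
  the extent of a tape (the smallest interval that contains the head position and all non-blank
  symbols) carry a separate mark \<open>Margin\<close>; for the blank tape every cell does.
\<close>

datatype 'a cell = Margin | Blank | Symbol 'a

definition cells :: "'a tape \<Rightarrow> int \<Rightarrow> 'a cell" where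
  "cells \<tau> i =
    (case fmlookup \<tau> i of
       Some a \<Rightarrow> Symbol a
     | None \<Rightarrow>
         if \<exists>j\<in>fmdom' \<tau>. (0 \<le> i \<and> i \<le> j) \<or> (j \<le> i \<and> i \<le> 0) then Blank else Margin)"

datatype direction = Left | Stay | Right

text \<open>
  A Turing machine is a finite table that assigns to a state and a scanned cell the cell to be
  written, the move of the head and the next state. State \<open>0\<close> is initial, and the machine halts
  when the table has no entry. In a configuration positions are counted from the head, so moving
  the head to the right shifts the contents to the left.
\<close>

type_synonym 'a machine = "(nat \<times> 'a cell, 'a cell \<times> direction \<times> nat) fmap"
type_synonym 'a config = "nat \<times> (int \<Rightarrow> 'a cell)"

fun offset :: "direction \<Rightarrow> int" where
  "offset Left = -1"
| "offset Stay = 0"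
| "offset Right = 1"

definition step :: "'a machine \<Rightarrow> 'a config \<Rightarrow> 'a config option" where
  "step M = (\<lambda>(q, t).
     map_option (\<lambda>(c, d, q'). (q', \<lambda>i. (t(0 := c)) (i + offset d))) (fmlookup M (q, t 0)))"

definition halts_with :: "'a machine \<Rightarrow> 'a tape \<Rightarrow> nat \<Rightarrow> 'a tape \<Rightarrow> bool" where
  "halts_with M \<tau> q \<tau>' \<longleftrightarrow>
     (\<lambda>c c'. step M c = Some c')\<^sup>*\<^sup>* (0, cells \<tau>) (q, cells \<tau>') \<and> step M (q, cells \<tau>') = None"

definition computable_on :: "'a tape set \<Rightarrow> ('a tape \<Rightarrow> 'a tape) \<Rightarrow> bool" where
  "computable_on Q f \<longleftrightarrow> (\<exists>M. \<forall>\<tau>\<in>Q. \<exists>q. halts_with M \<tau> q (f \<tau>))"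

text \<open>
  A machine decides a property by halting on every tape, the property holding exactly if it halts
  in a designated accepting state; it leaves the tape as it was.
\<close>

definition decidable :: "('a tape \<Rightarrow> bool) \<Rightarrow> bool" where
  "decidable P \<longleftrightarrow> (\<exists>M acc. \<forall>\<tau>. \<exists>q. halts_with M \<tau> q \<tau> \<and> (q = acc \<longleftrightarrow> P \<tau>))"

definition comp_enumerable :: "'a tape set \<Rightarrow> bool" where
  "comp_enumerable Q \<longleftrightarrow>
     (\<exists>h \<tau>0. computable_on Q h \<and> h \<in> Q \<rightarrow> Q \<and> \<tau>0 \<in> Q \<and> (\<forall>\<tau>\<in>Q. \<exists>i. \<tau> = (h ^^ i) \<tau>0))"

definition representation :: "'b set \<Rightarrow> ('b \<Rightarrow> 'a tape) \<Rightarrow> bool" where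
  "representation A x \<longleftrightarrow> inj_on x A"

definition comp_funs :: "'b set \<Rightarrow> ('b \<Rightarrow> 'a tape) \<Rightarrow> ('b \<Rightarrow> 'b) set" where
  "comp_funs A x = {g \<in> A \<rightarrow>\<^sub>E A. computable_on (x ` A) (x \<circ> g \<circ> inv_into A x)}"

definition transformationally_equivalent ::
    "'b set \<Rightarrow> ('b \<Rightarrow> 'a tape) \<Rightarrow> ('b \<Rightarrow> 'a tape) \<Rightarrow> bool" where
  "transformationally_equivalent A x y \<longleftrightarrow>
     computable_on (x ` A) (y \<circ> inv_into A x) \<and> computable_on (y ` A) (x \<circ> inv_into A y)"

text \<open>
  Partial application: a computable function, possibly defined on part of the tapes only, can be
  applied to the first component of a pair while the second component is kept.
\<close>

locale tape_pairing =
  fixes pair :: "'a::finite tape \<times> 'a tape \<Rightarrow> 'a tape"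
  assumes bij_pair: "bij pair"
    and duplication: "computable_on UNIV (\<lambda>\<tau>. pair (\<tau>, \<tau>))"
    and swap: "computable_on UNIV (pair \<circ> prod.swap \<circ> inv pair)"
    and projection1: "computable_on UNIV (fst \<circ> inv pair)"
    and projection2: "computable_on UNIV (snd \<circ> inv pair)"
    and partial_application:
      "\<And>Q f. computable_on Q f \<Longrightarrow>
         computable_on (pair ` (Q \<times> UNIV)) (pair \<circ> map_prod f id \<circ> inv pair)"
    and equality: "decidable (\<lambda>\<rho>. fst (inv pair \<rho>) = snd (inv pair \<rho>))"

end

theory Submission
  imports Defs
begin

text \<open>
  If \<open>h\<close> enumerates \<open>x ` A\<close> from \<open>\<tau>\<^sub>0\<close>, it represents a map \<open>g\<close> on \<open>A\<close>
  that is computable through \<open>x\<close>, hence through \<open>y\<close>, and whose iterates reach every element of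
  \<open>A\<close> from a single \<open>a\<^sub>0\<close>. To translate \<open>x a\<close> into \<open>y a\<close>, iterate the two copies
  of \<open>g\<close> in parallel from \<open>x a\<^sub>0\<close> and \<open>y a\<^sub>0\<close> until the first one hits \<open>x a\<close>, and
  return the second one. The argument is symmetric in \<open>x\<close> and \<open>y\<close>.
\<close>

section \<open>Linking machines\<close>

abbreviation reaches :: "'a machine \<Rightarrow> 'a config \<Rightarrow> 'a config \<Rightarrow> bool" where
  "reaches M \<equiv> (\<lambda>c c'. step M c = Some c')\<^sup>*\<^sup>*"

text \<open>Runs are described on arbitrary cell contents, since the content between two moves need
  not be \<open>cells \<tau>\<close> for any tape \<tau>.\<close>

definition exec :: "'a machine \<Rightarrow> (int \<Rightarrow> 'a cell) \<Rightarrow> nat \<Rightarrow> (int \<Rightarrow> 'a cell) \<Rightarrow> bool" where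
  "exec M t q t' \<longleftrightarrow> reaches M (0, t) (q, t') \<and> step M (q, t') = None"

lemma halts_with_iff_exec: "halts_with M \<tau> q \<tau>' \<longleftrightarrow> exec M (cells \<tau>) q (cells \<tau>')"
  by (simp add: halts_with_def exec_def)

lemma finite_UNIV_cell: "finite (UNIV :: 'a::finite cell set)"
proof -
  have "(UNIV :: 'a cell set) = insert Margin (insert Blank (range Symbol))"
    by (auto intro: cell.exhaust)
  then show ?thesis
    by (rule ssubst) simp
qed

lemma finite_dom_fmlookup_ex:
  assumes "finite (dom f)"
  obtains M where "fmlookup M = f"
  using assms Abs_fmap_inverse[of f] by auto

lemma step_eq_None_iff: "step M (q, t) = None \<longleftrightarrow> fmlookup M (q, t 0) = None"
  by (simp add: step_def)

lemma step_eq_Some_iff: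
  "step M (q, t) = Some (q', t') \<longleftrightarrow>
    (\<exists>c d. fmlookup M (q, t 0) = Some (c, d, q') \<and> t' = (\<lambda>i. (t(0 := c)) (i + offset d)))"
  by (auto simp: step_def)

text \<open>A finite superset of the states reachable from \<open>0\<close>. Entries that continue a
  halted machine are added for these states only, so the enlarged table stays finite.\<close>

definition states :: "'a machine \<Rightarrow> nat set" where
  "states M = insert 0 ((\<lambda>(c, d, q). q) ` ran (fmlookup M))"

lemma finite_states: "finite (states M)"
  by (simp add: states_def finite_ran)

lemma reaches_states: "reaches M (0, t) (q, t') \<Longrightarrow> q \<in> states M"
proof (induction "(q, t')" arbitrary: q t' rule: rtranclp_induct)
  case base
  then show ?case by (simp add: states_def)
next
  case (step c)
  obtain r s where "c = (r, s)" by (cases c)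
  with step(2) obtain c' d where "fmlookup M (r, s 0) = Some (c', d, q)"
    by (auto simp: step_eq_Some_iff)
  then show ?case
    unfolding states_def by (force intro: ranI)
qed

text \<open>Only moves are transferred, not halting: \<open>L\<close> may have entries where
  \<open>M\<close> stops, and this is what allows machines to be glued.\<close>

lemma reaches_rename:
  assumes "\<And>q c c' d q'. fmlookup M (q, c) = Some (c', d, q') \<Longrightarrow>
      fmlookup L (e q, c) = Some (c', d, e q')"
    and "reaches M (q, t) (q', t')"
  shows "reaches L (e q, t) (e q', t')"
  using assms(2)
proof (induction "(q', t')" arbitrary: q' t' rule: rtranclp_induct)
  case base
  then show ?case by simp
next
  case (step c)
  obtain r s where c: "c = (r, s)" by (cases c)
  with step(2) have "step L (e r, s) = Some (e q', t')"
    using assms(1) by (auto simp: step_eq_Some_iff)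
  with step(3)[OF c] show ?case
    by (rule rtranclp.rtrancl_into_rtrancl)
qed

lemma step_StayI: "fmlookup L (q, t 0) = Some (t 0, Stay, q') \<Longrightarrow> step L (q, t) = Some (q', t)"
  by (auto simp: step_eq_Some_iff)

text \<open>
  The linked machine uses the even states for \<open>M\<close> and the odd ones for \<open>N\<close>. It passes from \<open>M\<close>
  to \<open>N\<close> unless \<open>M\<close> halts in a state of \<open>E\<close>, and back from \<open>N\<close> to \<open>M\<close> if \<open>b\<close> holds.
\<close>

lemma link_ex:
  fixes M N :: "'a::finite machine" and E :: "nat set" and b :: bool
  obtains L where
    "\<And>t q t'. exec M t q t' \<Longrightarrow>
      if q \<in> E then exec L t (2 * q) t' else reaches L (0, t) (1, t')"
    "\<And>t q t'. exec N t q t' \<Longrightarrow>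
      if b then reaches L (1, t) (0, t')
      else reaches L (1, t) (2 * q + 1, t') \<and> step L (2 * q + 1, t') = None"
proof -
  \<comment> \<open>Where the simulated machine has no entry, the new entry rewrites the scanned
    cell and stays. Its target is the initial state of the other machine, encoded as
    \<open>1\<close> for \<open>N\<close> and \<open>0\<close> for \<open>M\<close>.\<close>
  define f :: "nat \<times> 'a cell \<Rightarrow> ('a cell \<times> direction \<times> nat) option" where
    "f = (\<lambda>(s, c).
      if even s then
        (case fmlookup M (s div 2, c) of
           Some (c', d, q') \<Rightarrow> Some (c', d, 2 * q')
         | None \<Rightarrow> if s div 2 \<in> states M - E then Some (c, Stay, 1) else None)
      else
        (case fmlookup N (s div 2, c) of
           Some (c', d, q') \<Rightarrow> Some (c', d, 2 * q' + 1)
         | None \<Rightarrow> if b \<and> s div 2 \<in> states N then Some (c, Stay, 0) else None))"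
  let ?D = "fmdom' M \<union> fmdom' N \<union> (states M \<union> states N) \<times> UNIV"
  have "dom f \<subseteq> (\<lambda>(q, c). (2 * q, c)) ` ?D \<union> (\<lambda>(q, c). (2 * q + 1, c)) ` ?D"
  proof
    fix p assume p: "p \<in> dom f"
    obtain s c where [simp]: "p = (s, c)" by (cases p)
    have D: "(s div 2, c) \<in> ?D"
      using p by (auto simp: f_def fmlookup_dom'_iff split: if_splits option.splits)
    have "s = 2 * (s div 2) \<or> s = 2 * (s div 2) + 1" by presburger
    then have "p = (\<lambda>(q, c). (2 * q, c)) (s div 2, c) \<or> p = (\<lambda>(q, c). (2 * q + 1, c)) (s div 2, c)"
      by simp
    with D show "p \<in> (\<lambda>(q, c). (2 * q, c)) ` ?D \<union> (\<lambda>(q, c). (2 * q + 1, c)) ` ?D"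
      by blast
  qed
  moreover have "finite ?D"
    by (simp add: finite_states finite_UNIV_cell)
  ultimately have "finite (dom f)"
    by (meson finite_UnI finite_imageI finite_subset)
  then obtain L where L: "fmlookup L = f"
    by (rule finite_dom_fmlookup_ex)
  have M: "reaches L (0, t) (2 * q, t')" if "exec M t q t'" for t q t'
    using reaches_rename[of M L "\<lambda>q. 2 * q" 0 t q t'] that
    by (simp add: exec_def L f_def)
  have N: "reaches L (1, t) (2 * q + 1, t')" if "exec N t q t'" for t q t'
    using reaches_rename[of N L "\<lambda>q. 2 * q + 1" 0 t q t'] that
    by (simp add: exec_def L f_def)
  show ?thesis
  proof
    fix t q t' assume e: "exec M t q t'"
    then have q: "fmlookup M (q, t' 0) = None" "q \<in> states M"
      using reaches_states[of M t q t'] by (simp_all add: exec_def step_eq_None_iff)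
    show "if q \<in> E then exec L t (2 * q) t' else reaches L (0, t) (1, t')"
    proof (cases "q \<in> E")
      case True
      then show ?thesis
        using M[OF e] q by (simp add: exec_def step_eq_None_iff L f_def)
    next
      case False
      then have "step L (2 * q, t') = Some (1, t')"
        using q by (intro step_StayI) (simp add: L f_def)
      with M[OF e] have "reaches L (0, t) (1, t')"
        by (rule rtranclp.rtrancl_into_rtrancl)
      with False show ?thesis by simp
    qed
  next
    fix t q t' assume e: "exec N t q t'"
    then have q: "fmlookup N (q, t' 0) = None" "q \<in> states N"
      using reaches_states[of N t q t'] by (simp_all add: exec_def step_eq_None_iff)
    show "if b then reaches L (1, t) (0, t')
      else reaches L (1, t) (2 * q + 1, t') \<and> step L (2 * q + 1, t') = None"
    proof (cases b)
      case True
      then have "step L (2 * q + 1, t') = Some (0, t')"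
        using q by (intro step_StayI) (simp add: L f_def)
      with N[OF e] have "reaches L (1, t) (0, t')"
        by (rule rtranclp.rtrancl_into_rtrancl)
      with True show ?thesis by simp
    next
      case False
      with N[OF e] q show ?thesis
        by (simp add: step_eq_None_iff L f_def)
    qed
  qed
qed

lemma seq_ex:
  fixes M N :: "'a::finite machine"
  obtains L where "\<And>t q t' r t''. exec M t q t' \<Longrightarrow> exec N t' r t'' \<Longrightarrow> exec L t (2 * r + 1) t''"
proof -
  obtain L where L: "\<And>t q t'. exec M t q t' \<Longrightarrow>
      if q \<in> {} then exec L t (2 * q) t' else reaches L (0, t) (1, t')"
    "\<And>t q t'. exec N t q t' \<Longrightarrow>
      if False then reaches L (1, t) (0, t')
      else reaches L (1, t) (2 * q + 1, t') \<and> step L (2 * q + 1, t') = None"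
    by (fact link_ex[of M "{}" N False])
  show ?thesis
  proof (rule that[of L])
    fix t q t' r t'' assume "exec M t q t'" "exec N t' r t''"
    then show "exec L t (2 * r + 1) t''"
      using L(1)[of t q t'] L(2)[of t' r t''] 
        rtranclp_trans[of "\<lambda>c c'. step L c = Some c'" "(0, t)" "(1, t')" "(2 * r + 1, t'')"]
      by (simp add: exec_def)
  qed
qed

section \<open>Closure properties of computable functions\<close>

lemma computable_on_cong:
  assumes "computable_on Q f" and "\<And>\<tau>. \<tau> \<in> Q' \<Longrightarrow> \<tau> \<in> Q \<and> f' \<tau> = f \<tau>"
  shows "computable_on Q' f'"
proof -
  obtain M where "\<And>\<tau>. \<tau> \<in> Q \<Longrightarrow> \<exists>q. halts_with M \<tau> q (f \<tau>)"
    using assms(1) unfolding computable_on_def by blast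
  then have "\<forall>\<tau>\<in>Q'. \<exists>q. halts_with M \<tau> q (f' \<tau>)"
    using assms(2) by simp
  then show ?thesis
    unfolding computable_on_def by blast
qed

lemma computable_on_compose:
  fixes f g :: "'a::finite tape \<Rightarrow> 'a tape"
  assumes "computable_on Q f" and "computable_on R g" and "\<And>\<tau>. \<tau> \<in> Q \<Longrightarrow> f \<tau> \<in> R"
  shows "computable_on Q (\<lambda>\<tau>. g (f \<tau>))"
proof -
  obtain M where M: "\<And>\<tau>. \<tau> \<in> Q \<Longrightarrow> \<exists>q. exec M (cells \<tau>) q (cells (f \<tau>))"
    using assms(1) by (auto simp: computable_on_def halts_with_iff_exec)
  obtain N where N: "\<And>\<tau>. \<tau> \<in> R \<Longrightarrow> \<exists>q. exec N (cells \<tau>) q (cells (g \<tau>))"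
    using assms(2) by (auto simp: computable_on_def halts_with_iff_exec)
  obtain L where L: "\<And>t q t' r t''. exec M t q t' \<Longrightarrow> exec N t' r t'' \<Longrightarrow> exec L t (2 * r + 1) t''"
    by (fact seq_ex)
  have "\<exists>q. exec L (cells \<tau>) q (cells (g (f \<tau>)))" if "\<tau> \<in> Q" for \<tau>
    using M[OF that] N[OF assms(3)[OF that]] L by blast
  then show ?thesis
    unfolding computable_on_def halts_with_iff_exec by blast
qed

text \<open>The loop alternates a test by the decider, which restores the tape, with one run of the
  machine for \<open>f\<close>. That machine runs only after a failed test, so \<open>f\<close> has
  to be computable only at the iterates before the first success.\<close>

lemma computable_on_while:
  fixes f r :: "'a::finite tape \<Rightarrow> 'a tape"
  assumes "decidable P" and "computable_on I f"
    and "\<And>\<tau>. \<tau> \<in> Q \<Longrightarrow>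
      \<exists>n. r \<tau> = (f ^^ n) \<tau> \<and> P ((f ^^ n) \<tau>) \<and> (\<forall>m<n. (f ^^ m) \<tau> \<in> I \<and> \<not> P ((f ^^ m) \<tau>))"
  shows "computable_on Q r"
proof -
  obtain D acc where D: "\<And>\<tau>. \<exists>q. exec D (cells \<tau>) q (cells \<tau>) \<and> (q = acc \<longleftrightarrow> P \<tau>)"
    using assms(1) by (auto simp: decidable_def halts_with_iff_exec)
  obtain M where M: "\<And>\<tau>. \<tau> \<in> I \<Longrightarrow> \<exists>q. exec M (cells \<tau>) q (cells (f \<tau>))"
    using assms(2) by (auto simp: computable_on_def halts_with_iff_exec)
  obtain L where L: "\<And>t q t'. exec D t q t' \<Longrightarrow>
      if q \<in> {acc} then exec L t (2 * q) t' else reaches L (0, t) (1, t')"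
    "\<And>t q t'. exec M t q t' \<Longrightarrow>
      if True then reaches L (1, t) (0, t')
      else reaches L (1, t) (2 * q + 1, t') \<and> step L (2 * q + 1, t') = None"
    by (fact link_ex[of D "{acc}" M True])
  have "\<exists>q. exec L (cells \<tau>) q (cells (r \<tau>))" if \<tau>: "\<tau> \<in> Q" for \<tau>
  proof -
    obtain n where n: "r \<tau> = (f ^^ n) \<tau>" "P ((f ^^ n) \<tau>)"
      and less: "\<And>m. m < n \<Longrightarrow> (f ^^ m) \<tau> \<in> I \<and> \<not> P ((f ^^ m) \<tau>)"
      using assms(3)[OF \<tau>] by blast
    have "reaches L (0, cells \<tau>) (0, cells ((f ^^ m) \<tau>))" if "m \<le> n" for m
      using that
    proof (induction m)
      case 0
      then show ?case by simp
    next
      case (Suc m)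
      let ?\<sigma> = "(f ^^ m) \<tau>"
      obtain q where "exec D (cells ?\<sigma>) q (cells ?\<sigma>)" "q \<noteq> acc"
        using D[of ?\<sigma>] less[of m] Suc.prems by auto
      then have "reaches L (0, cells ?\<sigma>) (1, cells ?\<sigma>)"
        using L(1) by fastforce
      moreover have "reaches L (1, cells ?\<sigma>) (0, cells (f ?\<sigma>))"
        using M[of ?\<sigma>] less[of m] Suc.prems L(2) by auto
      ultimately show ?case
        using Suc by (auto intro: rtranclp_trans)
    qed
    from this[of n] have "reaches L (0, cells \<tau>) (0, cells (r \<tau>))"
      by (simp add: n)
    \<comment> \<open>In round \<open>n\<close> the decider stops in \<open>acc\<close>, the one
      state from which the linked machine does not go on.\<close>
    moreover have "exec L (cells (r \<tau>)) (2 * acc) (cells (r \<tau>))"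
      using D[of "r \<tau>"] L(1)[of "cells (r \<tau>)" acc] n by auto
    ultimately show ?thesis
      unfolding exec_def by (meson rtranclp_trans)
  qed
  then show ?thesis
    by (auto simp: computable_on_def halts_with_iff_exec)
qed

section \<open>Constant functions\<close>

text \<open>The machine may depend on \<open>t\<close>, so one table entry is enough. This weak form
  suffices for constants: after erasing, the content no longer depends on the input.\<close>

lemma exec_single_ex: "\<exists>M q. exec M t q (\<lambda>i. (t(0 := c)) (i + offset d))"
proof -
  let ?M = "fmupd (0, t 0) (c, d, 1) fmempty"
  have "exec ?M t 1 (\<lambda>i. (t(0 := c)) (i + offset d))"
    unfolding exec_def
    by (auto simp: step_eq_None_iff step_eq_Some_iff intro!: r_into_rtranclp)
  then show ?thesis by blast
qed

lemma exec_trans_ex: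
  fixes t :: "int \<Rightarrow> 'a::finite cell"
  assumes "\<exists>M q. exec M t q t'" and "\<exists>M q. exec M t' q t''"
  shows "\<exists>M q. exec M t q t''"
proof -
  obtain M q N r where MN: "exec M t q t'" "exec N t' r t''"
    using assms by blast
  obtain L where "\<And>t q t' r t''. exec M t q t' \<Longrightarrow> exec N t' r t'' \<Longrightarrow> exec L t (2 * r + 1) t''"
    by (fact seq_ex)
  from this[OF MN] show ?thesis by blast
qed

text \<open>Positions are counted from the head, so a shift of the content is a walk of the head;
  each step writes back the scanned cell.\<close>

lemma exec_shift_ex:
  fixes t :: "int \<Rightarrow> 'a::finite cell"
  shows "\<exists>M q. exec M t q (\<lambda>i. t (i + k))"
proof (induction k rule: int_induct[where k = 0])
  case base
  then show ?case
    using exec_single_ex[of t "t 0" Stay] by simp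
next
  case (step1 k)
  then show ?case
    using exec_trans_ex[OF step1(2)] exec_single_ex[of "\<lambda>i. t (i + k)" "t k" Right]
    by (simp add: fun_upd_idem add_ac)
next
  case (step2 k)
  then show ?case
    using exec_trans_ex[OF step2(2)] exec_single_ex[of "\<lambda>i. t (i + k)" "t k" Left]
    by (simp add: fun_upd_idem algebra_simps)
qed

text \<open>Walk to position \<open>k\<close>, write there, and walk back.\<close>

lemma exec_upd_ex:
  fixes t :: "int \<Rightarrow> 'a::finite cell"
  shows "\<exists>M q. exec M t q (t(k := c))"
proof -
  let ?s = "\<lambda>i. t (i + k)"
  have "\<exists>M q. exec M ?s q (?s(0 := c))"
    using exec_single_ex[of ?s c Stay] by (simp add: fun_upd_def)
  with exec_shift_ex have "\<exists>M q. exec M t q (?s(0 := c))"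
    by (rule exec_trans_ex)
  then have "\<exists>M q. exec M t q (\<lambda>i. (?s(0 := c)) (i + - k))"
    using exec_shift_ex by (rule exec_trans_ex)
  moreover have "(\<lambda>i. (?s(0 := c)) (i + - k)) = t(k := c)"
    by auto
  ultimately show ?thesis by (simp only:)
qed

lemma exec_finite_change_ex:
  fixes t t' :: "int \<Rightarrow> 'a::finite cell"
  assumes "finite {i. t i \<noteq> t' i}"
  shows "\<exists>M q. exec M t q t'"
proof -
  have "\<exists>M q. exec M t q (\<lambda>i. if i \<in> S then t' i else t i)" if "finite S" for S
    using that
  proof (induction S rule: finite_induct)
    case empty
    then show ?case
      using exec_shift_ex[of t 0] by simp
  next
    case (insert k S)
    have "(\<lambda>i. if i \<in> insert k S then t' i else t i) = (\<lambda>i. if i \<in> S then t' i else t i)(k := t' k)"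
      by auto
    then show ?case
      using exec_trans_ex[OF insert(3) exec_upd_ex[of _ k "t' k"]] by (simp only:)
  qed
  from this[OF assms] show ?thesis
    by (rule back_subst[where P = "\<lambda>t'. \<exists>M q. exec M t q t'"]) auto
qed

text \<open>The right end is a natural number so that the walk of the erasing machine to the right
  can be treated by induction on it.\<close>

lemma cells_extent_ex:
  obtains l :: int and n :: nat
  where "{i. cells \<tau> i \<noteq> Margin} = {l..<int n}" and "l \<le> 0"
proof -
  let ?D = "fmdom' \<tau>"
  have eq: "{i. cells \<tau> i \<noteq> Margin} = {i. \<exists>j\<in>?D. (0 \<le> i \<and> i \<le> j) \<or> (j \<le> i \<and> i \<le> 0)}"
    by (force simp: cells_def fmlookup_dom'_iff split: option.splits)
  show ?thesis
  proof (cases "?D = {}")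
    case True
    then show ?thesis
      using that[of 0 0] eq by simp
  next
    case False
    have fin: "finite ?D" by simp
    \<comment> \<open>\<open>min 0\<close> and \<open>max 0\<close> occur because the extent also
      contains the head position; the \<open>+ 1\<close> makes the interval half-open.\<close>
    have "{i. \<exists>j\<in>?D. (0 \<le> i \<and> i \<le> j) \<or> (j \<le> i \<and> i \<le> 0)} =
        {min 0 (Min ?D)..<int (nat (max 0 (Max ?D) + 1))}" (is "?S = ?I")
    proof (intro set_eqI iffI)
      fix i assume "i \<in> ?S"
      then obtain j where j: "j \<in> ?D" "(0 \<le> i \<and> i \<le> j) \<or> (j \<le> i \<and> i \<le> 0)" by blast
      then have "Min ?D \<le> j" "j \<le> Max ?D" using fin by auto
      with j(2) show "i \<in> ?I" by auto
    next
      fix i assume i: "i \<in> ?I"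
      have "Min ?D \<in> ?D" "Max ?D \<in> ?D" "Min ?D \<le> Max ?D" using fin False by auto
      moreover have "(0 \<le> i \<and> i \<le> Max ?D) \<or> (Min ?D \<le> i \<and> i \<le> 0)"
        using i \<open>Min ?D \<le> Max ?D\<close> by auto
      ultimately show "i \<in> ?S" by blast
    qed
    then show ?thesis
      using that[of "min 0 (Min ?D)" "nat (max 0 (Max ?D) + 1)"] eq by simp
  qed
qed

text \<open>In state \<open>0\<close> the head runs to the right end of the extent, in state \<open>1\<close> it erases leftwards.\<close>

lemma erase_ex: "\<exists>M. \<forall>\<tau> :: 'a::finite tape. exec M (cells \<tau>) 1 (\<lambda>_. Margin)"
proof -
  define f :: "nat \<times> 'a cell \<Rightarrow> ('a cell \<times> direction \<times> nat) option" where
    "f = (\<lambda>(q, c).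
      if q = 0 then if c = Margin then Some (Margin, Left, 1) else Some (c, Right, 0)
      else if q = 1 \<and> c \<noteq> Margin then Some (Margin, Left, 1) else None)"
  have "dom f \<subseteq> {0, 1} \<times> UNIV"
    by (auto simp: f_def split: if_splits)
  then have "finite (dom f)"
    by (rule finite_subset) (simp add: finite_UNIV_cell)
  then obtain M where M: "fmlookup M = f"
    by (rule finite_dom_fmlookup_ex)
  \<comment> \<open>The \<open>n\<close> cells still to be erased end under the head. Erasing one
    and moving left leaves \<open>n - 1\<close> such cells.\<close>
  have erase: "reaches M (1, t) (1, \<lambda>_. Margin)" if "{i. t i \<noteq> Margin} = {1 - int n..0}" for n t
    using that
  proof (induction n arbitrary: t)
    case 0
    then have "t = (\<lambda>_. Margin)" by auto
    then show ?case by simp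
  next
    case (Suc n)
    let ?t = "\<lambda>i. (t(0 := Margin)) (i + offset Left)"
    have t: "t i \<noteq> Margin \<longleftrightarrow> - int n \<le> i \<and> i \<le> 0" for i
      using Suc.prems by (auto simp: set_eq_iff)
    have "step M (1, t) = Some (1, ?t)"
      using t[of 0] by (simp add: step_def M f_def cong: if_cong)
    moreover have "{i. ?t i \<noteq> Margin} = {1 - int n..0}"
      by (auto simp: t split: if_splits)
    ultimately show ?case
      using Suc.IH by (meson converse_rtranclp_into_rtranclp)
  qed
  \<comment> \<open>Here \<open>n\<close> is the distance from the head to the first
    \<open>Margin\<close> on its right. At \<open>n = 0\<close> the head stands on that cell and
    turns back, with \<open>- l\<close> cells left to erase.\<close>
  have run: "reaches M (0, t) (1, \<lambda>_. Margin)"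
    if "{i. t i \<noteq> Margin} = {l..<int n}" "l \<le> 0" for n l t
    using that
  proof (induction n arbitrary: l t)
    case 0
    let ?t = "\<lambda>i. (t(0 := Margin)) (i + offset Left)"
    have t: "t i \<noteq> Margin \<longleftrightarrow> l \<le> i \<and> i < 0" for i
      using 0 by (auto simp: set_eq_iff)
    have "step M (0, t) = Some (1, ?t)"
      using t[of 0] by (simp add: step_def M f_def cong: if_cong)
    moreover have "{i. ?t i \<noteq> Margin} = {1 - int (nat (- l))..0}"
      using 0(2) by (auto simp: t split: if_splits)
    ultimately show ?case
      using erase by (meson converse_rtranclp_into_rtranclp)
  next
    case (Suc n)
    let ?t = "\<lambda>i. t (i + 1)"
    have t: "t i \<noteq> Margin \<longleftrightarrow> l \<le> i \<and> i < 1 + int n" for i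
      using Suc.prems by (auto simp: set_eq_iff)
    have "step M (0, t) = Some (0, ?t)"
      using t[of 0] Suc.prems(2) by (auto simp: step_def M f_def fun_eq_iff)
    moreover have "{i. ?t i \<noteq> Margin} = {l - 1..<int n}"
      by (auto simp: t)
    moreover have "l - 1 \<le> 0"
      using Suc.prems(2) by simp
    ultimately show ?case
      using Suc.IH by (meson converse_rtranclp_into_rtranclp)
  qed
  have "exec M (cells \<tau>) 1 (\<lambda>_. Margin)" for \<tau>
  proof -
    obtain l :: int and n where "{i. cells \<tau> i \<noteq> Margin} = {l..<int n}" "l \<le> 0"
      by (rule cells_extent_ex)
    then show ?thesis
      using run by (simp add: exec_def step_eq_None_iff M f_def)
  qed
  then show ?thesis by blast
qed

text \<open>Erasing takes every input to the same content, from which one fixed machine writes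
  \<kappa>. Such constants supply the initial values of the search.\<close>

lemma computable_on_const:
  fixes \<kappa> :: "'a::finite tape"
  shows "computable_on UNIV (\<lambda>_. \<kappa>)"
proof -
  obtain M where M: "\<And>\<tau> :: 'a tape. exec M (cells \<tau>) 1 (\<lambda>_. Margin)"
    using erase_ex by blast
  obtain l :: int and n where "{i. cells \<kappa> i \<noteq> Margin} = {l..<int n}"
    by (rule cells_extent_ex)
  then have "finite {i. cells \<kappa> i \<noteq> Margin}"
    by simp
  then have "finite {i. Margin \<noteq> cells \<kappa> i}"
    by (simp add: eq_commute[of Margin])
  then obtain N q where N: "exec N (\<lambda>_. Margin) q (cells \<kappa>)"
    using exec_finite_change_ex[of "\<lambda>_. Margin" "cells \<kappa>"] by blast
  obtain L where "\<And>t q t' r t''. exec M t q t' \<Longrightarrow> exec N t' r t'' \<Longrightarrow> exec L t (2 * r + 1) t''"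
    by (fact seq_ex)
  from this[OF M N] show ?thesis
    unfolding computable_on_def halts_with_iff_exec by blast
qed

section \<open>Searching along an enumeration\<close>

context tape_pairing
begin

lemma inv_pair [simp]: "inv pair (pair p) = p"
  by (rule inv_f_f[OF bij_is_inj[OF bij_pair]])

lemma pair_eq_iff: "pair p = pair p' \<longleftrightarrow> p = p'"
  using bij_is_inj[OF bij_pair] by (simp add: inj_eq)

definition on_fst :: "('a tape \<Rightarrow> 'a tape) \<Rightarrow> 'a tape \<Rightarrow> 'a tape" where
  "on_fst f = pair \<circ> map_prod f id \<circ> inv pair"

definition on_snd :: "('a tape \<Rightarrow> 'a tape) \<Rightarrow> 'a tape \<Rightarrow> 'a tape" where
  "on_snd f = pair \<circ> map_prod id f \<circ> inv pair"

lemma on_fst_pair [simp]: "on_fst f (pair (\<sigma>, \<tau>)) = pair (f \<sigma>, \<tau>)"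
  by (simp add: on_fst_def)

lemma on_snd_pair [simp]: "on_snd f (pair (\<sigma>, \<tau>)) = pair (\<sigma>, f \<tau>)"
  by (simp add: on_snd_def)

lemma computable_on_fst: "computable_on Q f \<Longrightarrow> computable_on (pair ` (Q \<times> UNIV)) (on_fst f)"
  unfolding on_fst_def by (rule partial_application)

text \<open>Partial application acts on the first component, so \<open>on_fst f\<close> is
  conjugated by the swap.\<close>

lemma computable_on_snd:
  assumes "computable_on Q f"
  shows "computable_on (pair ` (UNIV \<times> Q)) (on_snd f)"
proof -
  let ?s = "pair \<circ> prod.swap \<circ> inv pair"
  have "computable_on (pair ` (UNIV \<times> Q)) ?s"
    using swap by (rule computable_on_cong) simp
  then have "computable_on (pair ` (UNIV \<times> Q)) (\<lambda>\<rho>. on_fst f (?s \<rho>))"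
    using computable_on_fst[OF assms] by (rule computable_on_compose) auto
  then have "computable_on (pair ` (UNIV \<times> Q)) (\<lambda>\<rho>. ?s (on_fst f (?s \<rho>)))"
    using swap by (rule computable_on_compose) simp
  then show ?thesis
    by (rule computable_on_cong) auto
qed

text \<open>Duplicate the input, then overwrite the second copy.\<close>

lemma computable_on_pair_const: "computable_on UNIV (\<lambda>\<tau>. pair (\<tau>, \<kappa>))"
proof -
  have "computable_on UNIV (\<lambda>\<tau>. on_snd (\<lambda>_. \<kappa>) (pair (\<tau>, \<tau>)))"
    using duplication computable_on_snd[OF computable_on_const[of \<kappa>]]
    by (rule computable_on_compose) auto
  then show ?thesis by simp
qed

text \<open>
  The decider compares the two components of a whole pair and nothing nested inside it. So
  the second copy of the iteration is stored in both components: the search keeps the tape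
  \<open>((\<tau>, y b), (x b, y b))\<close>, whose components agree exactly if \<open>\<tau> = x b\<close>.
\<close>

lemma computable_on_translation:
  fixes x y :: "'b \<Rightarrow> 'a tape"
  assumes inj: "inj_on x A" and g: "g \<in> A \<rightarrow> A" and a0: "a0 \<in> A"
    and reach: "\<And>a. a \<in> A \<Longrightarrow> \<exists>i. a = (g ^^ i) a0"
    and gx: "computable_on (x ` A) (x \<circ> g \<circ> inv_into A x)"
    and gy: "computable_on (y ` A) (y \<circ> g \<circ> inv_into A y)" and "inj_on y A"
  shows "computable_on (x ` A) (y \<circ> inv_into A x)"
proof -
  let ?fx = "x \<circ> g \<circ> inv_into A x" and ?fy = "y \<circ> g \<circ> inv_into A y"
  define state where "state \<tau> b = pair (pair (\<tau>, y b), pair (x b, y b))" for \<tau> b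
  \<comment> \<open>One round advances the three stored tapes from \<open>b\<close> to
    \<open>g b\<close> and keeps the target \<tau>.\<close>
  define body where "body \<rho> = on_snd (on_fst ?fx) (on_snd (on_snd ?fy) (on_fst (on_snd ?fy) \<rho>))"
    for \<rho>
  \<comment> \<open>The condition \<open>b \<in> A\<close> keeps the stored tapes in
    \<open>x\<close> A\<open>and\<close>y \<open>A\<close>, where the two copies of \<open>g\<close>
    are known to be computable.\<close>
  define I where "I = {state \<tau> b | \<tau> b. b \<in> A}"
  define P where "P \<rho> \<longleftrightarrow> fst (inv pair \<rho>) = snd (inv pair \<rho>)" for \<rho>
  have body: "body (state \<tau> b) = state \<tau> (g b)" if "b \<in> A" for \<tau> b
    using that inj \<open>inj_on y A\<close> by (simp add: body_def state_def)
  have P: "P (state \<tau> b) \<longleftrightarrow> \<tau> = x b" for \<tau> b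
    by (simp add: P_def state_def pair_eq_iff)
  have in_A: "(g ^^ i) a0 \<in> A" for i
    using g a0 by (induction i) auto
  have iter: "(body ^^ i) (state \<tau> a0) = state \<tau> ((g ^^ i) a0)" for i \<tau>
    by (induction i) (simp_all add: body in_A)

  have 1: "computable_on I (on_fst (on_snd ?fy))"
    using computable_on_fst[OF computable_on_snd[OF gy]]
    by (rule computable_on_cong) (auto simp: I_def state_def)
  have 2: "computable_on I (\<lambda>\<rho>. on_snd (on_snd ?fy) (on_fst (on_snd ?fy) \<rho>))"
    using 1 computable_on_snd[OF computable_on_snd[OF gy]]
    by (rule computable_on_compose) (auto simp: I_def state_def)
  have comp: "computable_on I body"
    unfolding body_def using 2 computable_on_snd[OF computable_on_fst[OF gx]]
    by (rule computable_on_compose) (auto simp: I_def state_def)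
  have dec: "decidable P"
    unfolding P_def by (rule equality)
  have found: "\<exists>n. state \<tau> (inv_into A x \<tau>) = (body ^^ n) (state \<tau> a0) \<and>
      P ((body ^^ n) (state \<tau> a0)) \<and>
      (\<forall>m<n. (body ^^ m) (state \<tau> a0) \<in> I \<and> \<not> P ((body ^^ m) (state \<tau> a0)))"
    if \<tau>: "\<tau> \<in> x ` A" for \<tau>
  proof -
    obtain a i where a: "a \<in> A" "\<tau> = x a" "a = (g ^^ i) a0"
      using \<tau> reach by blast
    \<comment> \<open>The least index is taken because the loop stops at the first hit; all earlier
      tests must fail.\<close>
    define n where "n = (LEAST i. \<tau> = x ((g ^^ i) a0))"
    have n: "\<tau> = x ((g ^^ n) a0)"
      unfolding n_def using a by (intro LeastI) blast
    then have "inv_into A x \<tau> = (g ^^ n) a0"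
      using inj in_A by simp
    moreover have "\<tau> \<noteq> x ((g ^^ m) a0)" if "m < n" for m
      using not_less_Least that unfolding n_def by blast
    ultimately show ?thesis
      using n in_A by (intro exI[of _ n]) (auto simp: iter P I_def)
  qed
  define Q where "Q = (\<lambda>\<tau>. state \<tau> a0) ` (x ` A)"
  \<comment> \<open>The result of the loop must be a function of the stored tape alone, so the
    target is read back from it.\<close>
  define r where
    "r \<rho> = (let \<tau> = fst (inv pair (fst (inv pair \<rho>))) in state \<tau> (inv_into A x \<tau>))" for \<rho>
  have r: "r (state \<tau> b) = state \<tau> (inv_into A x \<tau>)" for \<tau> b
    by (simp add: r_def state_def)
  have out: "snd (inv pair (snd (inv pair (state \<tau> b)))) = y b" for \<tau> b
    by (simp add: state_def)
  have search: "computable_on Q r"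
    using dec comp
  proof (rule computable_on_while)
    fix \<rho> assume "\<rho> \<in> Q"
    then obtain \<tau> where "\<tau> \<in> x ` A" "\<rho> = state \<tau> a0"
      unfolding Q_def by blast
    then show "\<exists>n. r \<rho> = (body ^^ n) \<rho> \<and> P ((body ^^ n) \<rho>) \<and>
        (\<forall>m<n. (body ^^ m) \<rho> \<in> I \<and> \<not> P ((body ^^ m) \<rho>))"
      using found[of \<tau>] r[of \<tau> a0] by simp
  qed
  have "computable_on UNIV (\<lambda>\<tau>. state \<tau> a0)"
    unfolding state_def
    \<comment> \<open>First attach \<open>y a0\<close>, then attach the constant pair of
      \<open>x a0\<close> and \<open>y a0\<close>.\<close>
    using computable_on_pair_const computable_on_pair_const by (rule computable_on_compose) simp
  then have "computable_on (x ` A) (\<lambda>\<tau>. state \<tau> a0)"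
    by (rule computable_on_cong) simp
  then have "computable_on (x ` A) (\<lambda>\<tau>. r (state \<tau> a0))"
    using search by (rule computable_on_compose) (auto simp: Q_def)
  then have "computable_on (x ` A) (\<lambda>\<tau>. (snd \<circ> inv pair) (r (state \<tau> a0)))"
    using projection2 by (rule computable_on_compose) simp
  then have "computable_on (x ` A) (\<lambda>\<tau>. (snd \<circ> inv pair) ((snd \<circ> inv pair) (r (state \<tau> a0))))"
    using projection2 by (rule computable_on_compose) simp
  then show ?thesis
    by (rule computable_on_cong) (simp add: r out)
qed

end

section \<open>Transport of the enumeration to \<open>A\<close>\<close>

theorem theorem10:
  fixes pair :: "'a::finite tape \<times> 'a tape \<Rightarrow> 'a tape"
    and A :: "'b set"
    and x y :: "'b \<Rightarrow> 'a tape"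
  assumes "tape_pairing pair"
    and "countable A"
    and "representation A x"
    and "representation A y"
    and "comp_funs A x \<subseteq> comp_funs A y"
    and "comp_enumerable (x ` A)"
  shows "transformationally_equivalent A x y"
proof -
  have inj: "inj_on x A" "inj_on y A"
    using assms(3,4) by (simp_all add: representation_def)
  obtain h \<tau>0 where h: "computable_on (x ` A) h" "h \<in> x ` A \<rightarrow> x ` A" and \<tau>0: "\<tau>0 \<in> x ` A"
    and enum: "\<And>\<tau>. \<tau> \<in> x ` A \<Longrightarrow> \<exists>i. \<tau> = (h ^^ i) \<tau>0"
    using assms(6) unfolding comp_enumerable_def by blast
  obtain a0 where a0: "a0 \<in> A" "\<tau>0 = x a0"
    using \<tau>0 by blast
  \<comment> \<open>\<open>g\<close> is \<open>h\<close> read through \<open>x\<close>;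
    \<open>restrict\<close> makes it extensional on \<open>A\<close>, as membership in
    \<open>comp_funs\<close> demands.\<close>
  define g where "g = restrict (inv_into A x \<circ> h \<circ> x) A"
  have x_g: "x (g a) = h (x a)" if "a \<in> A" for a
    using that funcset_mem[OF h(2), of "x a"] by (simp add: g_def f_inv_into_f)
  have g: "g \<in> A \<rightarrow>\<^sub>E A"
    using funcset_mem[OF h(2)] by (auto simp: g_def intro!: inv_into_into)
  have gx: "computable_on (x ` A) (x \<circ> g \<circ> inv_into A x)"
    using h(1) by (rule computable_on_cong) (auto simp: inj x_g)
  \<comment> \<open>The inclusion of the two classes is applied to this single function.\<close>
  then have "g \<in> comp_funs A y"
    using g assms(5) by (auto simp: comp_funs_def)
  then have gy: "computable_on (y ` A) (y \<circ> g \<circ> inv_into A y)"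
    by (simp add: comp_funs_def)
  have iter: "(g ^^ i) a0 \<in> A \<and> x ((g ^^ i) a0) = (h ^^ i) \<tau>0" for i
    using g by (induction i) (auto simp: a0 x_g)
  have reach: "\<exists>i. a = (g ^^ i) a0" if "a \<in> A" for a
  proof -
    obtain i where "x a = (h ^^ i) \<tau>0"
      using enum \<open>a \<in> A\<close> by blast
    then have "x a = x ((g ^^ i) a0)"
      using iter by simp
    then have "a = (g ^^ i) a0"
      using inj_onD[OF inj(1)] \<open>a \<in> A\<close> iter by blast
    then show ?thesis by blast
  qed
  have g': "g \<in> A \<rightarrow> A"
    using g by auto
  have "computable_on (x ` A) (y \<circ> inv_into A x)"
    using assms(1) inj(1) g' a0(1) reach gx gy inj(2)
    by (rule tape_pairing.computable_on_translation)
  \<comment> \<open>The iterates of \<open>g\<close> exhaust \<open>A\<close> itself, whichever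
    representation is used, so the same search works with \<open>x\<close> and \<open>y\<close>
    exchanged.\<close>
  moreover have "computable_on (y ` A) (x \<circ> inv_into A y)"
    using assms(1) inj(2) g' a0(1) reach gy gx inj(1)
    by (rule tape_pairing.computable_on_translation)
  ultimately show ?thesis
    unfolding transformationally_equivalent_def by (rule conjI)
qed

end
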